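(* Let $X$ be a real Hilbert space, let $T\colon X\to X$ be firmly nonexpansive, let $A\colon X\rightrightarrows X$ be maximally monotone, and suppose that $T=J_A$, or equivalently that $A=T^{-1}-\mathrm{Id}$. Then the following are equivalent: (i) $T$ is strictly firmly nonexpansive. (ii) $A$ is at most single-valued and strictly monotone. (iii) $\mathrm{Id}-T$ is strictly firmly nonexpansive. (iv) $A^{-1}$ is at most single-valued and strictly monotone. Consequently, strict firm nonexpansiveness is a self-dual property for firmly nonexpansive mappings; correspondingly, being both strictly monotone and at most single-valued is self-dual for maximally monotone operators.
   Context: $X$ is a real Hilbert space; $\mathrm{Id}$ is the identity on $X$. $T\colon X\to X$ is firmly nonexpansive if $\|Tx-Ty\|^2+\|(\mathrm{Id}-T)x-(\mathrm{Id}-T)y\|^2\leq\|x-y\|^2$ for all $x,y\in X$; it is strictly firmly nonexpansive if $x\neq y\Rightarrow\|Tx-Ty\|^2<\langle x-y,Tx-Ty\rangle$ for all $x,y\in X$. For $A\colon X\rightrightarrows X$ (so $Ax\subseteq X$ for each $x$): $\operatorname{gr}A=\{(x,u):u\in Ax\}$ and $x\in A^{-1}u\Leftrightarrow u\in Ax$. $A$ is at most single-valued if each $Ax$ has at most one element. $A$ is monotone if $\langle x-y,u-v\rangle\geq0$ for all $(x,u),(y,v)\in\operatorname{gr}A$; strictly monotone if $\langle x-y,u-v\rangle>0$ whenever $(x,u),(y,v)\in\operatorname{gr}A$ and $x\neq y$; maximally monotone if it is monotone with no proper monotone extension. The resolvent of a maximally monotone $A$ is $J_A=(\mathrm{Id}+A)^{-1}\colon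 X\to X$. A property of firmly nonexpansive mappings on $X$ is self-dual if, for every firmly nonexpansive $T\colon X\to X$, $T$ has it if and only if $\mathrm{Id}-T$ has it; a property of maximally monotone operators on $X$ is self-dual if, for every maximally monotone $A$, $A$ has it if and only if $A^{-1}$ has it. *)

theory Defs
  imports "HOL-Analysis.Analysis"
begin

text \<open>A real Hilbert space is a type of sort \<open>{real_inner, complete_space}\<close>. A set-valued
  operator on it is a function of type \<open>'a \<Rightarrow> 'a set\<close>, and a map \<open>T\<close> is identified with the
  operator sending \<open>x\<close> to the singleton of \<open>T x\<close>.\<close>

definition firmly_nonexpansive :: "('a::real_inner \<Rightarrow> 'a) \<Rightarrow> bool" where
  "firmly_nonexpansive T \<longleftrightarrow>
    (\<forall>x y. (norm (T x - T y))\<^sup>2 + (norm ((x - T x) - (y - T y)))\<^sup>2 \<le> (norm (x - y))\<^sup>2)"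

definition strictly_firmly_nonexpansive :: "('a::real_inner \<Rightarrow> 'a) \<Rightarrow> bool" where
  "strictly_firmly_nonexpansive T \<longleftrightarrow>
    (\<forall>x y. x \<noteq> y \<longrightarrow> (norm (T x - T y))\<^sup>2 < (x - y) \<bullet> (T x - T y))"

definition id_minus :: "('a::ab_group_add \<Rightarrow> 'a) \<Rightarrow> 'a \<Rightarrow> 'a" where
  "id_minus T = (\<lambda>x. x - T x)"

definition gr :: "('a \<Rightarrow> 'a set) \<Rightarrow> ('a \<times> 'a) set" where
  "gr A = {(x, u). u \<in> A x}"

definition op_of_map :: "('a \<Rightarrow> 'a) \<Rightarrow> 'a \<Rightarrow> 'a set" where
  "op_of_map T = (\<lambda>x. {T x})"

definition op_inverse :: "('a \<Rightarrow> 'a set) \<Rightarrow> 'a \<Rightarrow> 'a set" where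
  "op_inverse A = (\<lambda>u. {x. u \<in> A x})"

text \<open>Pointwise Minkowski sum and difference. The infix \<open>-\<close> on \<open>'a \<Rightarrow> 'a set\<close> would be
  pointwise set difference instead.\<close>

definition op_plus :: "('a::ab_group_add \<Rightarrow> 'a set) \<Rightarrow> ('a \<Rightarrow> 'a set) \<Rightarrow> 'a \<Rightarrow> 'a set" where
  "op_plus A B = (\<lambda>x. {u + v | u v. u \<in> A x \<and> v \<in> B x})"

definition op_minus :: "('a::ab_group_add \<Rightarrow> 'a set) \<Rightarrow> ('a \<Rightarrow> 'a set) \<Rightarrow> 'a \<Rightarrow> 'a set" where
  "op_minus A B = (\<lambda>x. {u - v | u v. u \<in> A x \<and> v \<in> B x})"

definition at_most_single_valued :: "('a \<Rightarrow> 'a set) \<Rightarrow> bool" where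
  "at_most_single_valued A \<longleftrightarrow> (\<forall>x. \<forall>u\<in>A x. \<forall>v\<in>A x. u = v)"

definition monotone_op :: "('a::real_inner \<Rightarrow> 'a set) \<Rightarrow> bool" where
  "monotone_op A \<longleftrightarrow> (\<forall>(x, u)\<in>gr A. \<forall>(y, v)\<in>gr A. (x - y) \<bullet> (u - v) \<ge> 0)"

definition strictly_monotone_op :: "('a::real_inner \<Rightarrow> 'a set) \<Rightarrow> bool" where
  "strictly_monotone_op A \<longleftrightarrow>
    (\<forall>(x, u)\<in>gr A. \<forall>(y, v)\<in>gr A. x \<noteq> y \<longrightarrow> (x - y) \<bullet> (u - v) > 0)"

definition maximally_monotone :: "('a::real_inner \<Rightarrow> 'a set) \<Rightarrow> bool" where
  "maximally_monotone A \<longleftrightarrow> monotone_op A \<and> \<not> (\<exists>B. monotone_op B \<and> gr A \<subset> gr B)"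

text \<open>The resolvent is kept as the operator \<open>(Id + A)\<^sup>-\<^sup>1\<close>, so that no choice of value is built
  into it: \<open>T = J_A\<close> reads \<open>op_of_map T = resolvent A\<close>, which says that
  \<open>(Id + A)\<^sup>-\<^sup>1 x\<close> is the singleton of \<open>T x\<close> for every \<open>x\<close>.\<close>

definition resolvent :: "('a::ab_group_add \<Rightarrow> 'a set) \<Rightarrow> 'a \<Rightarrow> 'a set" where
  "resolvent A = op_inverse (op_plus (op_of_map id) A)"

definition self_dual_map_property :: "(('a::real_inner \<Rightarrow> 'a) \<Rightarrow> bool) \<Rightarrow> bool" where
  "self_dual_map_property P \<longleftrightarrow> (\<forall>T. firmly_nonexpansive T \<longrightarrow> (P T \<longleftrightarrow> P (id_minus T)))"

definition self_dual_op_property :: "(('a::real_inner \<Rightarrow> 'a set) \<Rightarrow> bool) \<Rightarrow> bool" where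
  "self_dual_op_property P \<longleftrightarrow> (\<forall>A. maximally_monotone A \<longrightarrow> (P A \<longleftrightarrow> P (op_inverse A)))"

end

theory Submission
  imports Defs
begin

text \<open>Minty's parametrization \<open>p \<mapsto> (T p, p - T p)\<close> maps \<open>X\<close> onto the graph of \<open>A\<close> when
  \<open>T = J_A\<close>. Strict firm nonexpansiveness of \<open>T\<close> says that \<open>(x - y) \<bullet> (u - v) > 0\<close> for any two
  distinct points \<open>(x, u)\<close>, \<open>(y, v)\<close> of that graph, a condition symmetric in the two coordinates.
  On the operator side, the pairs with \<open>x \<noteq> y\<close> give strict monotonicity, and those with
  \<open>x = y\<close>, \<open>u \<noteq> v\<close> must not occur, which is single-valuedness.\<close>

text \<open>Expanding the inner product leaves \<open>(p - q) \<bullet> (T p - T q)\<close> minus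
  the squared norm of \<open>T p - T q\<close>. In this form \<open>T\<close> and
  \<open>Id - T\<close> enter symmetrically.\<close>

lemma strictly_firmly_nonexpansive_iff:
  "strictly_firmly_nonexpansive T \<longleftrightarrow>
    (\<forall>p q. p \<noteq> q \<longrightarrow> 0 < (T p - T q) \<bullet> ((p - T p) - (q - T q)))"
proof -
  have "(T p - T q) \<bullet> ((p - T p) - (q - T q)) = (p - q) \<bullet> (T p - T q) - (norm (T p - T q))\<^sup>2" for p q
    by (simp add: power2_norm_eq_inner inner_diff_left inner_diff_right inner_commute)
  then show ?thesis
    by (simp add: strictly_firmly_nonexpansive_def)
qed

lemma strictly_firmly_nonexpansive_id_minus:
  "strictly_firmly_nonexpansive (id_minus T) \<longleftrightarrow> strictly_firmly_nonexpansive T"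
  by (simp add: strictly_firmly_nonexpansive_iff id_minus_def inner_commute)

lemma strictly_monotone_single_valued_iff:
  "strictly_monotone_op A \<and> at_most_single_valued A \<longleftrightarrow>
    (\<forall>(x, u)\<in>gr A. \<forall>(y, v)\<in>gr A. (x, u) \<noteq> (y, v) \<longrightarrow> 0 < (x - y) \<bullet> (u - v))"
proof -
  have "at_most_single_valued A \<longleftrightarrow> (\<forall>(x, u)\<in>gr A. \<forall>(y, v)\<in>gr A. x = y \<longrightarrow> u = v)"
    by (auto simp: at_most_single_valued_def gr_def)
  \<comment> \<open>Distinct graph points with \<open>x = y\<close> would give inner product 0, so
    demanding positivity rules them out.\<close>
  then show ?thesis
    by (auto simp: strictly_monotone_op_def) force+
qed

text \<open>Inversion swaps the coordinates of the graph, and the condition on pairs of graph points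
  is invariant under this swap.\<close>

lemma strictly_monotone_single_valued_inverse_iff:
  "strictly_monotone_op (op_inverse A) \<and> at_most_single_valued (op_inverse A) \<longleftrightarrow>
    strictly_monotone_op A \<and> at_most_single_valued A"
proof -
  have "(\<forall>(x, u)\<in>gr (op_inverse A). \<forall>(y, v)\<in>gr (op_inverse A). (x, u) \<noteq> (y, v) \<longrightarrow>
      0 < (x - y) \<bullet> (u - v)) \<longleftrightarrow>
    (\<forall>(u, x)\<in>gr A. \<forall>(v, y)\<in>gr A. (u, x) \<noteq> (v, y) \<longrightarrow> 0 < (x - y) \<bullet> (u - v))"
    unfolding gr_def op_inverse_def by auto
  then show ?thesis
    unfolding strictly_monotone_single_valued_iff by (simp add: inner_commute)
qed

lemma op_of_map_eq_resolvent_iff: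
  "op_of_map T = resolvent A \<longleftrightarrow> (\<forall>p x. x = T p \<longleftrightarrow> p - x \<in> A x)"
proof -
  have "x \<in> resolvent A p \<longleftrightarrow> p - x \<in> A x" for p x
    by (force simp: resolvent_def op_inverse_def op_plus_def op_of_map_def)
  then show ?thesis
    by (auto simp: fun_eq_iff set_eq_iff op_of_map_def)
qed

lemma eq_inverse_minus_id_iff:
  "A = op_minus (op_inverse (op_of_map T)) (op_of_map id) \<longleftrightarrow>
    (\<forall>x u. u \<in> A x \<longleftrightarrow> x = T (u + x))"
proof -
  have "u \<in> op_minus (op_inverse (op_of_map T)) (op_of_map id) x \<longleftrightarrow> x = T (u + x)" for x u
    by (force simp: op_minus_def op_inverse_def op_of_map_def)
  then show ?thesis
    by (auto simp: fun_eq_iff set_eq_iff)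
qed

text \<open>Both equations become the same pointwise condition under the substitution
  \<open>p = u + x\<close>.\<close>

lemma resolvent_iff_eq_inverse_minus_id:
  "op_of_map T = resolvent A \<longleftrightarrow> A = op_minus (op_inverse (op_of_map T)) (op_of_map id)"
  unfolding op_of_map_eq_resolvent_iff eq_inverse_minus_id_iff
proof safe
  fix x u
  assume *: "\<forall>p x. x = T p \<longleftrightarrow> p - x \<in> A x"
  show "x = T (u + x)" if "u \<in> A x"
    using * that by (metis add_diff_cancel_right')
  show "u \<in> A x" if "x = T (u + x)"
    using * that by (metis add_diff_cancel_right')
next
  fix p x
  assume *: "\<forall>x u. u \<in> A x \<longleftrightarrow> x = T (u + x)"
  show "p - T p \<in> A (T p)"
    using * by simp
  show "x = T p" if "p - x \<in> A x"
    using * that by simp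
qed

lemma gr_eq_Minty_parametrization:
  assumes "op_of_map T = resolvent A"
  shows "gr A = range (\<lambda>p. (T p, p - T p))"
proof -
  have "u \<in> A x \<longleftrightarrow> x = T (u + x)" for x u
    using assms unfolding resolvent_iff_eq_inverse_minus_id eq_inverse_minus_id_iff by blast
  then show ?thesis
    by (force simp: gr_def)
qed

lemma strictly_firmly_nonexpansive_iff_resolvent:
  assumes "op_of_map T = resolvent A"
  shows "strictly_firmly_nonexpansive T \<longleftrightarrow> strictly_monotone_op A \<and> at_most_single_valued A"
  unfolding strictly_firmly_nonexpansive_iff strictly_monotone_single_valued_iff
    gr_eq_Minty_parametrization[OF assms]
  \<comment> \<open>The parametrization is injective, since the coordinates \<open>T p\<close> and
    \<open>p - T p\<close> add up to \<open>p\<close>; so distinct parameters correspond to distinct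
    graph points.\<close>
  by simp metis

theorem theorem3p5:
  shows "(\<forall>(T :: 'a::{real_inner, complete_space} \<Rightarrow> 'a) (A :: 'a \<Rightarrow> 'a set).
      firmly_nonexpansive T \<longrightarrow> maximally_monotone A \<longrightarrow>
        (op_of_map T = resolvent A \<longleftrightarrow>
          A = op_minus (op_inverse (op_of_map T)) (op_of_map id)) \<and>
        (op_of_map T = resolvent A \<longrightarrow>
          (strictly_firmly_nonexpansive T \<longleftrightarrow>
            at_most_single_valued A \<and> strictly_monotone_op A) \<and>
          (strictly_firmly_nonexpansive T \<longleftrightarrow>
            strictly_firmly_nonexpansive (id_minus T)) \<and>
          (strictly_firmly_nonexpansive T \<longleftrightarrow>
            at_most_single_valued (op_inverse A) \<and> strictly_monotone_op (op_inverse A)))) \<and>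
    self_dual_map_property (strictly_firmly_nonexpansive :: ('a \<Rightarrow> 'a) \<Rightarrow> bool) \<and>
    self_dual_op_property
      (\<lambda>A :: 'a \<Rightarrow> 'a set. strictly_monotone_op A \<and> at_most_single_valued A)"
  unfolding self_dual_map_property_def self_dual_op_property_def
    strictly_monotone_single_valued_inverse_iff strictly_firmly_nonexpansive_id_minus
  \<comment> \<open>The rewriting has turned both self-duality claims into trivial equivalences,
    closed by \<open>refl\<close>.\<close>
  by (intro conjI allI impI resolvent_iff_eq_inverse_minus_id refl)
    (use strictly_firmly_nonexpansive_iff_resolvent strictly_monotone_single_valued_inverse_iff
      in blast)+

end
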